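(* Let $\mathbb{F}_q$ be the finite field with $q$ elements, let $\mathcal{H}=\mathcal{H}(m,n,\mathcal{X},f)$ be the side information hypergraph of an instance $(m,n,\mathcal{X},f)$ of the index coding with side information (ICSI) problem, and let $\delta\ge 0$ be an integer. The length $\mathcal{N}_q(\mathcal{H},\delta)$ of an optimal linear $\delta$-error-correcting index code ($(\delta,\mathcal{H})$-ECIC) over $\mathbb{F}_q$ satisfies $$\mathcal{N}_q(\mathcal{H},\delta)\ \ge\ N_q[\alpha(\mathcal{H}),2\delta+1],$$ where $\alpha(\mathcal{H})$ is the generalized independence number of $\mathcal{H}$.
   Context: Notation: $[n]=\{1,\dots,n\}$; $\mathsf{wt}$ denotes Hamming weight; for $\boldsymbol{x}\in\mathbb{F}_q^n$ and $B\subseteq[n]$, $\boldsymbol{x}_B$ is the subvector of $\boldsymbol{x}$ indexed by $B$. Vectors are row vectors. ICSI instance: integers $m,n\ge 1$, subsets $\mathcal{X}_i\subseteq[n]$ for $i\in[m]$ with $\mathcal{X}=(\mathcal{X}_1,\dots,\mathcal{X}_m)$, and a map $f:[m]\to[n]$ with $f(i)\notin\mathcal{X}_i$ for all $i$. (Receiver $R_i$ knows $\boldsymbol{x}_{\mathcal{X}_i}$ and wants $x_{f(i)}$.) The side information hypergraph $\mathcal{H}(m,n,\mathcal{X},f)$ is the directed hypergraph with vertex set $[n]$ and edges $(f(i),\mathcal{X}_i)$, $i\in[m]$; it represents the instance. ECIC: a $\delta$-error-correcting index code ($(\delta,\mathcal{H})$-ECIC) over $\mathbb{F}_q$ of length $N$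 is a map $\mathfrak{E}:\mathbb{F}_q^n\to\mathbb{F}_q^N$ such that for each $i\in[m]$ there is a map $\mathfrak{D}_i:\mathbb{F}_q^N\times\mathbb{F}_q^{|\mathcal{X}_i|}\to\mathbb{F}_q$ with $\mathfrak{D}_i(\mathfrak{E}(\boldsymbol{x})+\boldsymbol{\epsilon}_i,\boldsymbol{x}_{\mathcal{X}_i})=x_{f(i)}$ for all $\boldsymbol{x}\in\mathbb{F}_q^n$ and all $\boldsymbol{\epsilon}_i\in\mathbb{F}_q^N$ with $\mathsf{wt}(\boldsymbol{\epsilon}_i)\le\delta$. It is linear if $\mathfrak{E}(\boldsymbol{x})=\boldsymbol{x}\boldsymbol{L}$ for some $n\times N$ matrix $\boldsymbol{L}$ over $\mathbb{F}_q$. $\mathcal{N}_q(\mathcal{H},\delta)$ is the smallest length of a linear $(\delta,\mathcal{H})$-ECIC over $\mathbb{F}_q$; a linear code attaining it is called optimal. $N_q[k,d]$ is the length of the shortest linear code over $\mathbb{F}_q$ of dimension $k$ and minimum distance $d$. Generalized independence number: let $\mathcal{Y}_i=[n]\setminus(\{f(i)\}\cup\mathcal{X}_i)$ and $\mathcal{J}(\mathcal{H})=\bigcup_{i\in[m]}\{\{f(i)\}\cup Y_i : Y_i\subseteq\mathcal{Y}_i\}$. A subset $H\subseteq[n]$ is a generalized independent set in $\mathcal{H}$ if every nonempty subset $K$ of $H$ belongs to $\mathcal{J}(\mathcal{H})$. $\alpha(\mathcal{H})$ is the largest size of a generalized independent set in $\mathcal{H}$. *)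

theory Defs
  imports Jordan_Normal_Form.DL_Rank Jordan_Normal_Form.DL_Submatrix
begin

text \<open>
  Index sets are 0-based, as for the vectors and matrices of \<^theory>\<open>Jordan_Normal_Form.Matrix\<close>:
  the set \<open>[n] = {1,...,n}\<close> is rendered as \<open>{..<n}\<close>.  The field with \<open>q\<close> elements is a
  type of sort \<open>{field, finite}\<close>.
\<close>

section \<open>Codes\<close>

definition hamming_weight :: "'a::zero vec \<Rightarrow> nat" where
  "hamming_weight v = card {i. i < dim_vec v \<and> v $ i \<noteq> 0}"

definition hamming_dist :: "'a vec \<Rightarrow> 'a vec \<Rightarrow> nat" where
  "hamming_dist v w = card {i. i < dim_vec v \<and> v $ i \<noteq> w $ i}"

text \<open>\<open>pick B j\<close> is the \<open>j\<close>-th smallest element of \<open>B\<close>, as in \<^const>\<open>submatrix\<close>.\<close>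

definition subvector :: "'a vec \<Rightarrow> nat set \<Rightarrow> 'a vec" where
  "subvector x B = vec (card B) (\<lambda>j. x $ pick B j)"

definition linear_code :: "nat \<Rightarrow> nat \<Rightarrow> 'q::field vec set \<Rightarrow> bool" where
  "linear_code N k C \<longleftrightarrow>
     VectorSpace.subspace class_ring C (module_vec TYPE('q) N) \<and>
     vectorspace.dim class_ring (module_vec TYPE('q) N\<lparr>carrier := C\<rparr>) = k"

text \<open>Only meaningful for codes with at least two words (over a finite alphabet).\<close>

definition min_distance :: "'a vec set \<Rightarrow> nat" where
  "min_distance C = Min {hamming_dist v w | v w. v \<in> C \<and> w \<in> C \<and> v \<noteq> w}"

text \<open>\<open>N\<^sub>q[k,d]\<close>, where the type argument stands for the field with \<open>q\<close> elements.\<close>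

definition shortest_code_length :: "'q::{field,finite} itself \<Rightarrow> nat \<Rightarrow> nat \<Rightarrow> nat" where
  "shortest_code_length _ k d =
     (LEAST N. \<exists>C :: 'q vec set. linear_code N k C \<and> min_distance C = d)"

section \<open>Index coding with side information\<close>

definition icsi_instance :: "nat \<Rightarrow> nat \<Rightarrow> (nat \<Rightarrow> nat set) \<Rightarrow> (nat \<Rightarrow> nat) \<Rightarrow> bool" where
  "icsi_instance m n X f \<longleftrightarrow>
     m \<ge> 1 \<and> n \<ge> 1 \<and> (\<forall>i<m. X i \<subseteq> {..<n} \<and> f i < n \<and> f i \<notin> X i)"

text \<open>
  A directed hypergraph with vertex set \<open>{..<num_vertices H}\<close>, whose edges
  \<open>(edge_head H i, edge_tail H i)\<close> are indexed by the receivers \<open>i < num_edges H\<close>.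
  The values of the two functions at other indices are never used.
\<close>

record directed_hypergraph =
  num_edges :: nat
  num_vertices :: nat
  edge_tail :: "nat \<Rightarrow> nat set"
  edge_head :: "nat \<Rightarrow> nat"

definition side_info_hypergraph ::
    "nat \<Rightarrow> nat \<Rightarrow> (nat \<Rightarrow> nat set) \<Rightarrow> (nat \<Rightarrow> nat) \<Rightarrow> directed_hypergraph" where
  "side_info_hypergraph m n X f =
     \<lparr>num_edges = m, num_vertices = n, edge_tail = X, edge_head = f\<rparr>"

section \<open>Error-correcting index codes\<close>

definition ecic ::
    "nat \<Rightarrow> directed_hypergraph \<Rightarrow> nat \<Rightarrow> ('q::{field,finite} vec \<Rightarrow> 'q vec) \<Rightarrow> bool" where
  "ecic \<delta> H N E \<longleftrightarrow>
     E \<in> carrier_vec (num_vertices H) \<rightarrow> carrier_vec N \<and>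
     (\<forall>i < num_edges H. \<exists>D :: 'q vec \<Rightarrow> 'q vec \<Rightarrow> 'q.
        \<forall>x \<in> carrier_vec (num_vertices H). \<forall>\<epsilon> \<in> carrier_vec N.
          hamming_weight \<epsilon> \<le> \<delta> \<longrightarrow>
          D (E x + \<epsilon>) (subvector x (edge_tail H i)) = x $ edge_head H i)"

text \<open>The row vector \<open>x L\<close> is the column vector \<open>L\<^sup>T x\<close>.\<close>

definition linear_ecic ::
    "nat \<Rightarrow> directed_hypergraph \<Rightarrow> nat \<Rightarrow> ('q::{field,finite} vec \<Rightarrow> 'q vec) \<Rightarrow> bool" where
  "linear_ecic \<delta> H N E \<longleftrightarrow>
     ecic \<delta> H N E \<and>
     (\<exists>L \<in> carrier_mat (num_vertices H) N.
        \<forall>x \<in> carrier_vec (num_vertices H). E x = transpose_mat L *\<^sub>v x)"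

definition optimal_ecic_length ::
    "'q::{field,finite} itself \<Rightarrow> directed_hypergraph \<Rightarrow> nat \<Rightarrow> nat" where
  "optimal_ecic_length _ H \<delta> =
     (LEAST N. \<exists>E :: 'q vec \<Rightarrow> 'q vec. linear_ecic \<delta> H N E)"

section \<open>Generalized independence number\<close>

definition unknown_indices :: "directed_hypergraph \<Rightarrow> nat \<Rightarrow> nat set" where
  "unknown_indices H i = {..<num_vertices H} - ({edge_head H i} \<union> edge_tail H i)"

definition confusable_supports :: "directed_hypergraph \<Rightarrow> nat set set" where
  "confusable_supports H =
     (\<Union>i \<in> {..<num_edges H}. {{edge_head H i} \<union> Y | Y. Y \<subseteq> unknown_indices H i})"

definition generalized_independent :: "directed_hypergraph \<Rightarrow> nat set \<Rightarrow> bool" where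
  "generalized_independent H S \<longleftrightarrow>
     S \<subseteq> {..<num_vertices H} \<and> (\<forall>K \<subseteq> S. K \<noteq> {} \<longrightarrow> K \<in> confusable_supports H)"

definition generalized_independence_number :: "directed_hypergraph \<Rightarrow> nat" where
  "generalized_independence_number H = Max {card S | S. generalized_independent H S}"

end

theory Submission
  imports Defs
begin

text \<open>Restrict the matrix \<open>L\<close> of an optimal code to the rows of a maximum generalized independent
  set \<open>S\<close>.  The support of a nonzero message \<open>x\<close> supported in \<open>S\<close> has the form
  \<open>{f i} \<union> Y\<close> with \<open>Y\<close> unknown to receiver \<open>i\<close>, so this receiver has to distinguish \<open>x\<close> from
  \<open>0\<close> and hence \<open>x L\<close> has weight at least \<open>2 \<delta> + 1\<close>.  The restricted rows therefore generate a
  code of dimension \<open>|S|\<close> and minimum distance at least \<open>2 \<delta> + 1\<close>.\<close>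

section \<open>Linear codes of given dimension and minimum distance\<close>

lemma hamming_dist_eq_weight_diff:
  fixes v w :: "'a::group_add vec"
  assumes "v \<in> carrier_vec N" "w \<in> carrier_vec N"
  shows "hamming_dist v w = hamming_weight (v - w)"
proof -
  have "{i. i < dim_vec v \<and> v $ i \<noteq> w $ i} = {i. i < dim_vec (v - w) \<and> (v - w) $ i \<noteq> 0}"
    using assms by auto
  then show ?thesis unfolding hamming_dist_def hamming_weight_def by simp
qed

text \<open>The image is the column space, so its dimension is the rank of \<open>A\<close>. A
  trivial kernel forces the columns to be independent. Their distinctness is proved separately
  because \<open>lin_indpt\<close> sees only the set of columns and would not notice a
  repetition.\<close>

lemma injective_imp_linear_code:
  fixes A :: "'q::field mat"
  assumes A: "A \<in> carrier_mat N k"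
    and inj: "\<And>v. v \<in> carrier_vec k \<Longrightarrow> v \<noteq> 0\<^sub>v k \<Longrightarrow> A *\<^sub>v v \<noteq> 0\<^sub>v N"
  shows "linear_code N k ((\<lambda>v. A *\<^sub>v v) ` carrier_vec k)"
proof -
  interpret vec_space "TYPE('q)" N .
  have cols_carrier: "set (cols A) \<subseteq> carrier_vec N" using A cols_dim by blast
  have "distinct (cols A)"
  proof (rule ccontr)
    assume "\<not> distinct (cols A)"
    then obtain i j where ij: "i < k" "j < k" "i \<noteq> j" "col A i = col A j"
      using A by (auto simp: distinct_conv_nth)
    \<comment> \<open>Two equal columns would put this nonzero vector in the kernel.\<close>
    define v :: "'q vec" where "v = unit_vec k i - unit_vec k j"
    have v: "v \<in> carrier_vec k" unfolding v_def by simp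
    have "v $ i = 1" using ij by (simp add: v_def)
    then have v0: "v \<noteq> 0\<^sub>v k" using ij by auto
    have "A $$ (r, i) = A $$ (r, j)" if "r < N" for r
      using index_col[of r A i] index_col[of r A j] ij that A by simp
    then have "A *\<^sub>v v = 0\<^sub>v N"
      unfolding v_def mult_minus_distrib_mat_vec[OF A unit_vec_carrier unit_vec_carrier]
      using A ij by (auto intro!: eq_vecI)
    then show False using inj[OF v v0] by contradiction
  qed
  moreover have "lin_indpt (set (cols A))"
    using lin_depE[OF A] \<open>distinct (cols A)\<close> inj by metis
  ultimately have "rank A = k" using lin_indpt_full_rank A by blast
  moreover have "VectorSpace.subspace class_ring (col_space A) V"
    unfolding col_space_def using span_is_subspace cols_carrier by simp
  moreover have "(\<lambda>v. A *\<^sub>v v) ` carrier_vec k = col_space A"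
    unfolding col_space_eq[OF A] using A by auto
  ultimately show ?thesis
    unfolding linear_code_def rank_def col_space_def by simp
qed

text \<open>Zeroing \<open>wt c - d\<close> coordinates in the support of a minimum weight word \<open>c\<close> leaves the
  length unchanged and makes the minimum distance exactly \<open>d\<close>.\<close>

lemma exists_linear_code_min_distance:
  fixes A :: "'q::{field,finite} mat"
  assumes A: "A \<in> carrier_mat N k" and "k \<ge> 1" "d \<ge> 1"
    and wt: "\<And>v. v \<in> carrier_vec k \<Longrightarrow> v \<noteq> 0\<^sub>v k \<Longrightarrow> d \<le> hamming_weight (A *\<^sub>v v)"
  shows "\<exists>C :: 'q vec set. linear_code N k C \<and> min_distance C = d"
proof -
  define W where "W = (\<lambda>v. hamming_weight (A *\<^sub>v v))"
  have "unit_vec k 0 \<in> carrier_vec k \<and> unit_vec k 0 \<noteq> (0\<^sub>v k :: 'q vec)"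
    using \<open>k \<ge> 1\<close> by auto
  \<comment> \<open>The image of \<open>u\<close> under \<open>A\<close> is the minimum weight word
    \<open>c\<close>.\<close>
  then obtain u where u: "u \<in> carrier_vec k" "u \<noteq> 0\<^sub>v k"
    and umin: "\<And>v. v \<in> carrier_vec k \<Longrightarrow> v \<noteq> 0\<^sub>v k \<Longrightarrow> W u \<le> W v"
    using ex_has_least_nat[of "\<lambda>v. v \<in> carrier_vec k \<and> v \<noteq> 0\<^sub>v k" _ W] by metis
  define supp where "supp v = {i. i < N \<and> (A *\<^sub>v v) $ i \<noteq> 0}" for v
  have W: "W v = card (supp v)" for v
    using A by (simp add: W_def hamming_weight_def supp_def)
  have fin: "finite (supp v)" for v by (simp add: supp_def)
  have "W u \<ge> d" using wt u by (simp add: W_def)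
  then obtain T where T: "T \<subseteq> supp u" "card T = W u - d"
    using obtain_subset_with_card_n[of "W u - d" "supp u"] W by (metis diff_le_self)
  have finT: "finite T" using T fin finite_subset by blast
  define B where "B = mat N k (\<lambda>(i, j). if i \<in> T then 0 else A $$ (i, j))"
  have B: "B \<in> carrier_mat N k" by (simp add: B_def)
  have Bv: "(B *\<^sub>v v) $ i = (if i \<in> T then 0 else (A *\<^sub>v v) $ i)"
    if "i < N" "v \<in> carrier_vec k" for i v
    using that A by (auto simp: B_def scalar_prod_def)
  have wB: "hamming_weight (B *\<^sub>v v) = card (supp v - T)" if "v \<in> carrier_vec k" for v
  proof -
    have "{i. i < dim_vec (B *\<^sub>v v) \<and> (B *\<^sub>v v) $ i \<noteq> 0} = supp v - T"
      using B Bv that by (auto simp: supp_def simp del: index_mult_mat_vec split: if_splits)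
    then show ?thesis by (simp add: hamming_weight_def)
  qed
  \<comment> \<open>Zeroing costs a word at most \<open>card T = W u - d\<close>, and every nonzero
    \<open>v\<close> starts with at least \<open>W u\<close>.\<close>
  have wB_ge: "d \<le> hamming_weight (B *\<^sub>v v)" if "v \<in> carrier_vec k" "v \<noteq> 0\<^sub>v k" for v
    using diff_card_le_card_Diff[OF finT, of "supp v"] umin[OF that] \<open>W u \<ge> d\<close> T W wB that
    by simp
  \<comment> \<open>Since \<open>T\<close> lies inside \<open>supp u\<close>, here the loss is
    exactly \<open>W u - d\<close>.\<close>
  have wBu: "hamming_weight (B *\<^sub>v u) = d"
    using wB[OF u(1)] card_Diff_subset[OF finT T(1)] T(2) \<open>W u \<ge> d\<close> W by simp
  define C where "C = (\<lambda>v. B *\<^sub>v v) ` carrier_vec k"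
  have "linear_code N k C"
    unfolding C_def
  proof (rule injective_imp_linear_code[OF B])
    fix v :: "'q vec" assume "v \<in> carrier_vec k" "v \<noteq> 0\<^sub>v k"
    then have "1 \<le> hamming_weight (B *\<^sub>v v)" using wB_ge \<open>d \<ge> 1\<close> order_trans by blast
    moreover have "hamming_weight (0\<^sub>v N :: 'q vec) = 0" by (simp add: hamming_weight_def)
    ultimately show "B *\<^sub>v v \<noteq> 0\<^sub>v N" by fastforce
  qed
  moreover have "min_distance C = d"
    unfolding min_distance_def
  proof (rule Min_eqI)
    have "hamming_dist v w \<le> N" if "v \<in> C" for v w
    proof -
      have "dim_vec v = N" using that B by (auto simp: C_def)
      then have "{i. i < dim_vec v \<and> v $ i \<noteq> w $ i} \<subseteq> {..<N}" by auto
      then show ?thesis unfolding hamming_dist_def using card_mono[of "{..<N}"] by simp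
    qed
    then have "{hamming_dist v w |v w. v \<in> C \<and> w \<in> C \<and> v \<noteq> w} \<subseteq> {..N}" by blast
    then show "finite {hamming_dist v w |v w. v \<in> C \<and> w \<in> C \<and> v \<noteq> w}"
      using finite_subset[of _ "{..N}"] by blast
  next
    fix e assume "e \<in> {hamming_dist v w |v w. v \<in> C \<and> w \<in> C \<and> v \<noteq> w}"
    then obtain x y where x: "x \<in> carrier_vec k" and y: "y \<in> carrier_vec k"
      and ne: "B *\<^sub>v x \<noteq> B *\<^sub>v y" and e: "e = hamming_dist (B *\<^sub>v x) (B *\<^sub>v y)"
      by (auto simp: C_def)
    have "e = hamming_weight (B *\<^sub>v x - B *\<^sub>v y)"
      unfolding e using B x y by (intro hamming_dist_eq_weight_diff[of _ N]) auto
    also have "B *\<^sub>v x - B *\<^sub>v y = B *\<^sub>v (x - y)"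
      using mult_minus_distrib_mat_vec[OF B x y] by simp
    finally have "e = hamming_weight (B *\<^sub>v (x - y))" .
    moreover have "x - y \<noteq> 0\<^sub>v k"
    proof
      assume "x - y = 0\<^sub>v k"
      then have "x = y" using x y by (auto simp: vec_eq_iff)
      then show False using ne by simp
    qed
    ultimately show "d \<le> e" using wB_ge x y by simp
  next
    \<comment> \<open>The distance \<open>d\<close> is attained between the shortened minimum weight
      word and the zero word.\<close>
    have "hamming_dist (B *\<^sub>v u) (B *\<^sub>v 0\<^sub>v k) = d"
    proof -
      have "B *\<^sub>v 0\<^sub>v k = 0\<^sub>v N" using B by auto
      moreover have "B *\<^sub>v u - 0\<^sub>v N = B *\<^sub>v u" using B u by auto
      ultimately show ?thesis using hamming_dist_eq_weight_diff[of "B *\<^sub>v u" N "0\<^sub>v N"] B u wBu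
        by simp
    qed
    moreover from this have "B *\<^sub>v u \<noteq> B *\<^sub>v 0\<^sub>v k"
      using \<open>d \<ge> 1\<close> by (auto simp: hamming_dist_def)
    ultimately show "d \<in> {hamming_dist v w |v w. v \<in> C \<and> w \<in> C \<and> v \<noteq> w}"
      using u unfolding C_def by (intro CollectI exI[of _ "B *\<^sub>v u"] exI[of _ "B *\<^sub>v 0\<^sub>v k"]) auto
  qed
  ultimately show ?thesis by blast
qed

section \<open>The weight that error correction forces on codewords\<close>

text \<open>One error vector cancels up to \<delta> entries of \<open>z\<close>, and the other
  consists of the entries that remain. Thus \<delta> errors on each side make \<open>z\<close> and
  the zero word indistinguishable.\<close>

lemma hamming_weight_le_double_split:
  fixes z :: "'a::group_add vec"
  assumes z: "z \<in> carrier_vec N" and wt: "hamming_weight z \<le> 2 * \<delta>"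
  obtains e e' where "e \<in> carrier_vec N" "e' \<in> carrier_vec N"
    "hamming_weight e \<le> \<delta>" "hamming_weight e' \<le> \<delta>" "z + e = e'"
proof -
  let ?S = "{i. i < N \<and> z $ i \<noteq> 0}"
  have S: "card ?S \<le> 2 * \<delta>" using z wt by (simp add: hamming_weight_def)
  \<comment> \<open>The minimum covers supports smaller than \<delta>, which are cancelled
    completely.\<close>
  obtain T where T: "T \<subseteq> ?S" "card T = min \<delta> (card ?S)"
    using obtain_subset_with_card_n[of "min \<delta> (card ?S)" ?S] by auto
  have "finite T" using T(1) finite_subset by fastforce
  define e where "e = vec N (\<lambda>i. if i \<in> T then - z $ i else 0)"
  define e' where "e' = vec N (\<lambda>i. if i \<in> T then 0 else z $ i)"
  have "{i. i < dim_vec e \<and> e $ i \<noteq> 0} = T"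
    using T(1) by (auto simp: e_def split: if_splits)
  then have 1: "hamming_weight e \<le> \<delta>" using T(2) by (simp add: hamming_weight_def)
  have "{i. i < dim_vec e' \<and> e' $ i \<noteq> 0} = ?S - T"
    by (auto simp: e'_def split: if_splits)
  then have "hamming_weight e' = card ?S - card T"
    using card_Diff_subset[OF \<open>finite T\<close> T(1)] by (simp add: hamming_weight_def)
  then have 2: "hamming_weight e' \<le> \<delta>" using S T(2) by auto
  have "z + e = e'" using z by (auto simp: e_def e'_def)
  with 1 2 show thesis by (intro that[of e e']) (auto simp: e_def e'_def)
qed

text \<open>If \<open>E x\<close> had weight at most 2\<delta>, suitable errors would turn
  \<open>E x\<close> and \<open>E 0\<close> into the same received word. Receiver \<open>i\<close>
  also has the same side information for \<open>x\<close> and 0, namely zeros, so its decoder would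
  return one value for two different demands.\<close>

lemma ecic_weight_lower_bound:
  fixes E :: "'q::{field,finite} vec \<Rightarrow> 'q vec"
  assumes E: "ecic \<delta> H N E" and E0: "E (0\<^sub>v (num_vertices H)) = 0\<^sub>v N"
    and i: "i < num_edges H" and tail: "edge_tail H i \<subseteq> {..<num_vertices H}"
    and head: "edge_head H i < num_vertices H"
    and x: "x \<in> carrier_vec (num_vertices H)" "x $ edge_head H i \<noteq> 0"
    and x0: "\<And>j. j \<in> edge_tail H i \<Longrightarrow> x $ j = 0"
  shows "2 * \<delta> + 1 \<le> hamming_weight (E x)"
proof (rule ccontr)
  let ?n = "num_vertices H" and ?B = "edge_tail H i"
  assume "\<not> ?thesis"
  moreover have Ex: "E x \<in> carrier_vec N" using E x by (auto simp: ecic_def)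
  ultimately obtain e e' where e: "e \<in> carrier_vec N" "e' \<in> carrier_vec N"
    "hamming_weight e \<le> \<delta>" "hamming_weight e' \<le> \<delta>" "E x + e = e'"
    using hamming_weight_le_double_split[of "E x" N \<delta>] by auto
  obtain D where D: "\<And>x e. x \<in> carrier_vec ?n \<Longrightarrow> e \<in> carrier_vec N \<Longrightarrow> hamming_weight e \<le> \<delta> \<Longrightarrow>
      D (E x + e) (subvector x ?B) = x $ edge_head H i"
    using E i unfolding ecic_def by meson
  have pick: "pick ?B j \<in> ?B" if "j < card ?B" for j
    using pick_in_set_le[OF that] .
  have "subvector x ?B = subvector (0\<^sub>v ?n) ?B"
    unfolding subvector_def using x0 pick tail by (intro eq_vecI) (auto simp: subset_iff)
  moreover have "E x + e = E (0\<^sub>v ?n) + e'" using e E0 by simp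
  ultimately have "x $ edge_head H i = 0\<^sub>v ?n $ edge_head H i"
    using D[of x e] D[of "0\<^sub>v ?n" e'] x e by simp
  then show False using x head by simp
qed

section \<open>Existence of linear error-correcting index codes\<close>

text \<open>Balls of radius \<delta> around codewords with different demanded symbols are disjoint,
  so the received word alone determines the symbol and the decoder can ignore the side
  information.\<close>

lemma ecicI_hamming_dist:
  fixes E :: "'q::{field,finite} vec \<Rightarrow> 'q vec"
  assumes E: "E \<in> carrier_vec (num_vertices H) \<rightarrow> carrier_vec N"
    and dist: "\<And>i x y. i < num_edges H \<Longrightarrow> x \<in> carrier_vec (num_vertices H) \<Longrightarrow>
      y \<in> carrier_vec (num_vertices H) \<Longrightarrow> x $ edge_head H i \<noteq> y $ edge_head H i \<Longrightarrow>
      2 * \<delta> + 1 \<le> hamming_dist (E x) (E y)"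
  shows "ecic \<delta> H N E"
  unfolding ecic_def
proof (intro conjI allI impI)
  fix i assume i: "i < num_edges H"
  \<comment> \<open>\<open>?P z x\<close> says that at most \<delta> errors can turn the codeword of
    \<open>x\<close> into \<open>z\<close>.\<close>
  let ?P = "\<lambda>z x. x \<in> carrier_vec (num_vertices H) \<and>
      (\<exists>e \<in> carrier_vec N. hamming_weight e \<le> \<delta> \<and> E x + e = z)"
  have unique: "x $ edge_head H i = y $ edge_head H i" if x: "?P z x" and y: "?P z y" for x y z
  proof (rule ccontr)
    assume "x $ edge_head H i \<noteq> y $ edge_head H i"
    then have far: "2 * \<delta> + 1 \<le> hamming_dist (E x) (E y)" using dist i x y by blast
    from x y obtain e e' where e: "e \<in> carrier_vec N" "hamming_weight e \<le> \<delta>"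
      "e' \<in> carrier_vec N" "hamming_weight e' \<le> \<delta>" and eq: "E x + e = E y + e'" by metis
    have car: "E x \<in> carrier_vec N" "E y \<in> carrier_vec N" using E x y by auto
    have "E x $ j + e $ j = E y $ j + e' $ j" if "j < N" for j
      using arg_cong[OF eq, of "\<lambda>v. v $ j"] that e car by simp
    \<comment> \<open>Where the codewords differ, at least one of the two errors must be
      nonzero.\<close>
    then have "{j. j < dim_vec (E x) \<and> E x $ j \<noteq> E y $ j}
        \<subseteq> {j. j < dim_vec e \<and> e $ j \<noteq> 0} \<union> {j. j < dim_vec e' \<and> e' $ j \<noteq> 0}"
      using e car by force
    then have "hamming_dist (E x) (E y) \<le> hamming_weight e + hamming_weight e'"
      unfolding hamming_dist_def hamming_weight_def
      by (intro order_trans[OF card_mono card_Un_le]) auto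
    then show False using far e by simp
  qed
  show "\<exists>D. \<forall>x\<in>carrier_vec (num_vertices H). \<forall>\<epsilon>\<in>carrier_vec N. hamming_weight \<epsilon> \<le> \<delta> \<longrightarrow>
      D (E x + \<epsilon>) (subvector x (edge_tail H i)) = x $ edge_head H i"
  \<comment> \<open>The decoder picks any message compatible with the received word; by
    \<open>unique\<close> all of them agree in the demanded coordinate.\<close>
  proof (intro exI[of _ "\<lambda>z _. (SOME x. ?P z x) $ edge_head H i"] ballI impI)
    fix x \<epsilon> :: "'q vec"
    assume "x \<in> carrier_vec (num_vertices H)" "\<epsilon> \<in> carrier_vec N" "hamming_weight \<epsilon> \<le> \<delta>"
    then have "?P (E x + \<epsilon>) x" by blast
    then show "(SOME y. ?P (E x + \<epsilon>) y) $ edge_head H i = x $ edge_head H i"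
      using unique someI[of "?P (E x + \<epsilon>)" x] by blast
  qed
qed (rule E)

text \<open>Repeating every coordinate \<open>2 \<delta> + 1\<close> times is an ECIC, so the \<open>LEAST\<close> in
  \<^const>\<open>optimal_ecic_length\<close> is attained.\<close>

lemma exists_linear_ecic:
  assumes head: "\<And>i. i < num_edges H \<Longrightarrow> edge_head H i < num_vertices H"
  shows "\<exists>N. \<exists>E :: 'q::{field,finite} vec \<Rightarrow> 'q vec. linear_ecic \<delta> H N E"
proof -
  let ?n = "num_vertices H" and ?r = "2 * \<delta> + 1"
  define N where "N = ?n * ?r"
  \<comment> \<open>Position \<open>j\<close> of the codeword carries a copy of message coordinate
    \<open>j div ?r\<close>.\<close>
  define L :: "'q mat" where "L = mat ?n N (\<lambda>(i, j). if j div ?r = i then 1 else 0)"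
  define E where "E x = transpose_mat L *\<^sub>v x" for x
  have L: "L \<in> carrier_mat ?n N" by (simp add: L_def)
  have E_nth: "E x $ j = x $ (j div ?r)" if "x \<in> carrier_vec ?n" "j < N" for x j
  proof -
    have "j div ?r < ?n" using that(2) unfolding N_def by (simp add: less_mult_imp_div_less)
    moreover have "E x $ j = (\<Sum>i = 0..<?n. (if j div ?r = i then 1 else 0) * x $ i)"
      using that unfolding E_def L_def by (simp add: scalar_prod_def)
    moreover have "\<dots> = (\<Sum>i = 0..<?n. if i = j div ?r then x $ i else 0)"
      by (intro sum.cong) auto
    ultimately show ?thesis by simp
  qed
  have "ecic \<delta> H N E"
  proof (rule ecicI_hamming_dist)
    show "E \<in> carrier_vec ?n \<rightarrow> carrier_vec N" using L by (auto simp: E_def)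
    fix i and x y :: "'q vec" assume i: "i < num_edges H" and x: "x \<in> carrier_vec ?n"
      and y: "y \<in> carrier_vec ?n" and ne: "x $ edge_head H i \<noteq> y $ edge_head H i"
    let ?h = "edge_head H i"
    have dim: "dim_vec (E x) = N" using L by (simp add: E_def)
    \<comment> \<open>This block holds the \<open>?r\<close> copies of the demanded coordinate, so
      the codewords differ throughout it.\<close>
    have "{?h * ?r..<Suc ?h * ?r} \<subseteq> {j. j < dim_vec (E x) \<and> E x $ j \<noteq> E y $ j}"
    proof
      fix j assume "j \<in> {?h * ?r..<Suc ?h * ?r}"
      then have j: "?h * ?r \<le> j" "j < Suc ?h * ?r" by auto
      then have "j div ?r = ?h" by (intro div_nat_eqI) (simp_all add: mult.commute)
      moreover have "Suc ?h * ?r \<le> N" using head[OF i] unfolding N_def by (intro mult_right_mono) auto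
      then have "j < N" using j by linarith
      ultimately show "j \<in> {j. j < dim_vec (E x) \<and> E x $ j \<noteq> E y $ j}"
        using ne E_nth x y dim by simp
    qed
    then have "card {?h * ?r..<Suc ?h * ?r} \<le> hamming_dist (E x) (E y)"
      unfolding hamming_dist_def by (intro card_mono) auto
    then show "?r \<le> hamming_dist (E x) (E y)" by simp
  qed
  then have "linear_ecic \<delta> H N E" using L unfolding linear_ecic_def E_def by blast
  then show ?thesis by blast
qed

section \<open>From an index code to a classical code, and the bound\<close>

lemma linear_ecic_imp_linear_code:
  fixes E :: "'q::{field,finite} vec \<Rightarrow> 'q vec"
  assumes E: "linear_ecic \<delta> H N E"
    and tail: "\<And>i. i < num_edges H \<Longrightarrow> edge_tail H i \<subseteq> {..<num_vertices H}"
    and head: "\<And>i. i < num_edges H \<Longrightarrow> edge_head H i \<notin> edge_tail H i"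
    and S: "generalized_independent H S" "S \<noteq> {}"
  shows "\<exists>C :: 'q vec set. linear_code N (card S) C \<and> min_distance C = 2 * \<delta> + 1"
proof -
  let ?n = "num_vertices H" and ?k = "card S"
  have Sn: "S \<subseteq> {..<?n}" using S by (simp add: generalized_independent_def)
  then have "finite S" using finite_subset by blast
  then obtain s where s: "bij_betw s {0..<?k} S" using ex_bij_betw_nat_finite by blast
  from E obtain L where L: "L \<in> carrier_mat ?n N"
    and EL: "\<And>x. x \<in> carrier_vec ?n \<Longrightarrow> E x = transpose_mat L *\<^sub>v x"
    unfolding linear_ecic_def by blast
  have ecic: "ecic \<delta> H N E" using E by (simp add: linear_ecic_def)
  \<comment> \<open>\<open>P\<close> embeds vectors of length \<open>card S\<close> as the messages
    supported in \<open>S\<close>, enumerated by \<open>s\<close>. Hence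
    \<open>transpose_mat L * P\<close> is the transpose of the rows of \<open>L\<close> indexed by
    \<open>S\<close>.\<close>
  define P :: "'q mat" where "P = mat ?n ?k (\<lambda>(i, j). if s j = i then 1 else 0)"
  have P: "P \<in> carrier_mat ?n ?k" by (simp add: P_def)
  have Py: "(P *\<^sub>v y) $ i = (\<Sum>j = 0..<?k. if s j = i then y $ j else 0)"
    if "i < ?n" "y \<in> carrier_vec ?k" for y i
    using that unfolding P_def by (auto simp: scalar_prod_def intro!: sum.cong)
  have E0: "E (0\<^sub>v ?n) = 0\<^sub>v N" using EL[of "0\<^sub>v ?n"] L by auto
  have LT: "transpose_mat L \<in> carrier_mat N ?n" using L by simp
  show ?thesis
  proof (rule exists_linear_code_min_distance)
    show "transpose_mat L * P \<in> carrier_mat N ?k" using LT P by simp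
    show "1 \<le> ?k" using \<open>S \<noteq> {}\<close> \<open>finite S\<close> by (simp add: Suc_le_eq card_gt_0_iff)
    show "1 \<le> 2 * \<delta> + 1" by simp
    fix y :: "'q vec" assume y: "y \<in> carrier_vec ?k" "y \<noteq> 0\<^sub>v ?k"
    define x where "x = P *\<^sub>v y"
    define K where "K = {i. i < ?n \<and> x $ i \<noteq> 0}"
    have x: "x \<in> carrier_vec ?n" using P y by (simp add: x_def)
    have "K \<subseteq> S"
    proof
      fix i assume i: "i \<in> K"
      show "i \<in> S"
      proof (rule ccontr)
        assume "i \<notin> S"
        then have "s j \<noteq> i" if "j < ?k" for j using s that by (auto simp: bij_betw_def)
        then have "x $ i = 0" using i Py y by (auto simp: x_def K_def intro!: sum.neutral)
        then show False using i by (simp add: K_def)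
      qed
    qed
    moreover have "K \<noteq> {}"
    proof -
      obtain l where l: "l < ?k" "y $ l \<noteq> 0" using y by (metis eq_vecI carrier_vecD index_zero_vec)
      then have "s l < ?n" using s Sn by (auto simp: bij_betw_def)
      \<comment> \<open>Injectivity of \<open>s\<close> leaves a single term, so \<open>x\<close>
        inherits the nonzero entry of \<open>y\<close>.\<close>
      moreover have "x $ s l = (\<Sum>j = 0..<?k. if j = l then y $ j else 0)"
        unfolding x_def Py[OF \<open>s l < ?n\<close> y(1)]
        using s l by (intro sum.cong) (auto simp: bij_betw_def inj_on_def)
      ultimately have "s l \<in> K" using l by (simp add: K_def)
      then show ?thesis by blast
    qed
    ultimately have "K \<in> confusable_supports H"
      using S by (simp add: generalized_independent_def)
    then obtain i Y where i: "i < num_edges H" and K: "K = {edge_head H i} \<union> Y"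
      and Y: "Y \<subseteq> unknown_indices H i" by (auto simp: confusable_supports_def)
    have h: "edge_head H i \<in> K" using K by simp
    show "2 * \<delta> + 1 \<le> hamming_weight (transpose_mat L * P *\<^sub>v y)"
    proof -
      have "2 * \<delta> + 1 \<le> hamming_weight (E x)"
      proof (rule ecic_weight_lower_bound[OF ecic E0 i tail[OF i] _ x])
        show "edge_head H i < ?n" "x $ edge_head H i \<noteq> 0" using h by (simp_all add: K_def)
        fix j assume j: "j \<in> edge_tail H i"
        \<comment> \<open>The tail misses \<open>Y\<close>, which is unknown to receiver
          \<open>i\<close>, and misses the head by the instance condition; so the side information
          of \<open>x\<close> is zero.\<close>
        then have "j \<notin> K" using K Y head[OF i] by (auto simp: unknown_indices_def)
        then show "x $ j = 0" using j tail[OF i] by (auto simp: K_def)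
      qed
      also have "E x = transpose_mat L * P *\<^sub>v y"
        using EL[OF x] assoc_mult_mat_vec[OF LT P y(1)] by (simp add: x_def)
      finally show ?thesis .
    qed
  qed
qed

theorem theoremV1:
  fixes m n \<delta> :: nat and X :: "nat \<Rightarrow> nat set" and f :: "nat \<Rightarrow> nat"
  assumes "icsi_instance m n X f"
  shows "optimal_ecic_length TYPE('q::{field,finite}) (side_info_hypergraph m n X f) \<delta>
    \<ge> shortest_code_length TYPE('q)
        (generalized_independence_number (side_info_hypergraph m n X f)) (2 * \<delta> + 1)"
proof -
  let ?H = "side_info_hypergraph m n X f"
  let ?\<alpha> = "generalized_independence_number ?H"
  let ?N = "optimal_ecic_length TYPE('q) ?H \<delta>"
  let ?G = "{card S | S. generalized_independent ?H S}"
  have m: "0 < m" and inst: "\<And>i. i < m \<Longrightarrow> X i \<subseteq> {..<n} \<and> f i < n \<and> f i \<notin> X i"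
    using assms by (auto simp: icsi_instance_def)
  \<comment> \<open>The singleton of a demanded index gives \<alpha> at least 1, so the code has two
    distinct words and its minimum distance is meaningful.\<close>
  have "generalized_independent ?H {f 0}"
    unfolding generalized_independent_def confusable_supports_def
  proof (intro conjI allI impI)
    show "{f 0} \<subseteq> {..<num_vertices ?H}" using inst m by (simp add: side_info_hypergraph_def)
    fix K assume "K \<subseteq> {f 0}" "K \<noteq> {}"
    then have "K = {edge_head ?H 0} \<union> {}" by (auto simp: side_info_hypergraph_def)
    then show "K \<in> (\<Union>i\<in>{..<num_edges ?H}.
        {{edge_head ?H i} \<union> Y |Y. Y \<subseteq> unknown_indices ?H i})"
      using m by (intro UN_I[of 0]) (auto simp: side_info_hypergraph_def)
  qed
  then have "card {f 0} \<in> ?G" by blast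
  then have one: "1 \<in> ?G" by simp
  have "?G \<subseteq> card ` Pow {..<n}"
    by (auto simp: generalized_independent_def side_info_hypergraph_def)
  then have fin: "finite ?G" using finite_subset by blast
  have "?\<alpha> \<in> ?G" unfolding generalized_independence_number_def using Max_in[OF fin] one by blast
  then obtain S where S: "generalized_independent ?H S" "?\<alpha> = card S" by auto
  have "1 \<le> ?\<alpha>" unfolding generalized_independence_number_def using Max_ge[OF fin one] .
  then have "S \<noteq> {}" using S by auto
  have "\<exists>N. \<exists>E :: 'q vec \<Rightarrow> 'q vec. linear_ecic \<delta> ?H N E"
    using inst by (intro exists_linear_ecic) (simp add: side_info_hypergraph_def)
  from LeastI_ex[OF this] obtain E :: "'q vec \<Rightarrow> 'q vec" where E: "linear_ecic \<delta> ?H ?N E"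
    unfolding optimal_ecic_length_def by blast
  have "\<exists>C :: 'q vec set. linear_code ?N ?\<alpha> C \<and> min_distance C = 2 * \<delta> + 1"
    unfolding S(2) using inst
    by (intro linear_ecic_imp_linear_code[OF E _ _ S(1) \<open>S \<noteq> {}\<close>])
      (simp_all add: side_info_hypergraph_def)
  then show ?thesis
    unfolding shortest_code_length_def by (rule Least_le)
qed

end
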